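(* Let $C\in\mathbb{R}^{L\times 2}$, $d\in\mathbb{R}^{L}$, $A_m\in\mathbb{R}^{L_m\times 2}$, $b_m\in\mathbb{R}^{L_m}$, and let $\mathcal{V}=\{x\in\mathbb{R}^2 : Cx\le d\}$ (the controlled vessel) and $\mathcal{O}_m=\{x\in\mathbb{R}^2 : A_m x\le b_m\}$ (the $m$-th obstacle) be nonempty convex polyhedra. Let $d_{\mathrm{safe}}\in\mathbb{R}$. Then $$\mathrm{sd}(\mathcal{V},\mathcal{O}_m)\ge d_{\mathrm{safe}}$$ if and only if there exist $\lambda_m\in\mathbb{R}^{L}$ and $\mu_m\in\mathbb{R}^{L_m}$ with $\lambda_m\ge 0$, $\mu_m\ge 0$ and $A_m^\top\mu_m\neq 0$ such that $$\frac{-\lambda_m^\top d-\mu_m^\top b_m}{\|A_m^\top\mu_m\|}\ge d_{\mathrm{safe}}\qquad\text{and}\qquad C^\top\lambda_m+A_m^\top\mu_m=0.$$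
   Context: Vector inequalities are componentwise and $\|\cdot\|$ is the Euclidean norm on $\mathbb{R}^2$. For sets $\mathcal{V},\mathcal{O}\subset\mathbb{R}^2$ and $z\in\mathbb{R}^2$, write $\mathcal{V}+z=\{v+z : v\in\mathcal{V}\}$. The signed distance is $$\mathrm{sd}(\mathcal{V},\mathcal{O})=\mathrm{dist}(\mathcal{V},\mathcal{O})-\mathrm{pen}(\mathcal{V},\mathcal{O}),$$ where $$\mathrm{dist}(\mathcal{V},\mathcal{O})=\inf_{z\in\mathbb{R}^2}\{\|z\| : (\mathcal{V}+z)\cap\mathcal{O}\neq\emptyset\}$$ is the distance and $$\mathrm{pen}(\mathcal{V},\mathcal{O})=\inf_{z\in\mathbb{R}^2}\{\|z\| : (\mathcal{V}+z)\cap\mathcal{O}=\emptyset\}$$ is the penetration depth, with the convention $\inf\emptyset=+\infty$ (this can only occur in $\mathrm{pen}$ for unbounded sets, in which case $\mathrm{sd}=-\infty$). The rows of $C$ (resp. $A_m$) are the outward normal vectors of the $L$ edges of $\mathcal{V}$ (resp. the $L_m$ edges of $\mathcal{O}_m$). In the application, the sets are posed copies of base shapes $\{x : \tilde{C}x\le\tilde d\}$ and $\{x : \tilde A_m x\le\tilde b_m\}$, i.e. $C=\tilde C R^\top(\psi)$, $d=\tilde d+\tilde C R^\top(\psi) r$, $A_m=\tilde A_m R^\top(\psi_m)$, $b_m=\tilde b_m+\tilde A_m R^\top(\psi_m) r_m$, where $R(\cdot)$ is the planar rotation matrix, $r,r_m\in\mathbb{R}^2$ are positions and $\psi,\psi_m$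 are headings. *)

theory Defs
  imports "HOL-Analysis.Analysis"
begin

text \<open>
  The signed distance takes values in \<^typ>\<open>ereal\<close>: there the infimum of the empty set is
  \<open>\<infinity>\<close>, so the penetration depth is \<open>\<infinity>\<close> and the signed distance is \<open>-\<infinity>\<close> when no
  translation makes two nonempty sets disjoint. For nonempty sets the distance is finite, so the
  difference below is never of the form \<open>\<infinity> - \<infinity>\<close>.
\<close>

definition set_distance :: "(real^2) set \<Rightarrow> (real^2) set \<Rightarrow> ereal" where
  "set_distance S T = (INF z\<in>{z. ((\<lambda>v. v + z) ` S) \<inter> T \<noteq> {}}. ereal (norm z))"

definition penetration_depth :: "(real^2) set \<Rightarrow> (real^2) set \<Rightarrow> ereal" where
  "penetration_depth S T = (INF z\<in>{z. ((\<lambda>v. v + z) ` S) \<inter> T = {}}. ereal (norm z))"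

definition signed_distance :: "(real^2) set \<Rightarrow> (real^2) set \<Rightarrow> ereal" where
  "signed_distance S T = set_distance S T - penetration_depth S T"

text \<open>
  The order on \<^typ>\<open>real^'n\<close> is componentwise (\<open>less_eq_vec_def\<close>), so
  \<open>C *v x \<le> d\<close> is the system of linear inequalities given by the rows of \<open>C\<close>.
\<close>

end

theory Submission
  imports Defs
begin

text \<open>
  Let \<open>M\<close> be the set of differences \<open>o - v\<close> with \<open>v\<close> in the vessel and \<open>o\<close> in the obstacle. The
  distance is the distance from \<open>0\<close> to \<open>M\<close> and the penetration depth is the distance from \<open>0\<close> to the
  complement of \<open>M\<close>. As \<open>M\<close> is convex, separating hyperplanes show that the signed distance is at least
  \<open>\<delta>\<close> iff some unit vector \<open>n\<close> satisfies \<open>n \<bullet> z \<le> -\<delta>\<close> on \<open>M\<close>, that is, iff the suprema of \<open>n\<close> over the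
  obstacle and of \<open>-n\<close> over the vessel add up to at most \<open>-\<delta>\<close>. By linear programming duality
  these two suprema are certified by nonnegative multipliers \<open>\<mu>\<close> and \<open>\<lambda>\<close>.
\<close>

section \<open>Linear programming duality from closedness of finitely generated cones\<close>

lemma convex_cone_hull_Basis:
  "convex_cone hull Basis = {x :: 'a::euclidean_space. \<forall>i\<in>Basis. 0 \<le> x \<bullet> i}"
proof (intro equalityI subsetI)
  fix x :: 'a assume "x \<in> convex_cone hull Basis"
  moreover have "convex_cone {x :: 'a. \<forall>i\<in>Basis. 0 \<le> x \<bullet> i}"
    unfolding convex_cone_iff by (auto simp: inner_add_left)
  then have "convex_cone hull Basis \<subseteq> {x :: 'a. \<forall>i\<in>Basis. 0 \<le> x \<bullet> i}"
    by (intro hull_minimal) (auto simp: inner_Basis)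
  ultimately show "x \<in> {x. \<forall>i\<in>Basis. 0 \<le> x \<bullet> i}" by blast
next
  fix x :: 'a assume x: "x \<in> {x. \<forall>i\<in>Basis. 0 \<le> x \<bullet> i}"
  have sum_mem: "(\<Sum>i\<in>B. (x \<bullet> i) *\<^sub>R i) \<in> convex_cone hull Basis" if "finite B" "B \<subseteq> Basis" for B
    using that
  proof (induction B rule: finite_induct)
    case empty
    show ?case by (simp add: convex_cone_hull_contains_0)
  next
    case (insert i B)
    then show ?case
      using x by (auto intro!: convex_cone_hull_add convex_cone_hull_mul intro: hull_inc)
  qed
  show "x \<in> convex_cone hull Basis"
    using sum_mem[of Basis] by (simp add: euclidean_representation)
qed

text \<open>The orthant is generated by the finitely many basis vectors, so its image is generated
  by their images, and finitely generated cones are closed. A linear image of an arbitrary closed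
  cone can fail to be closed.\<close>

lemma closed_linear_image_nonneg_orthant:
  fixes f :: "'a::euclidean_space \<Rightarrow> 'b::euclidean_space"
  assumes "linear f"
  shows "closed (f ` {x. \<forall>i\<in>Basis. 0 \<le> x \<bullet> i})"
  using closed_convex_cone_hull[of "f ` Basis"] convex_cone_hull_linear_image[OF assms, of Basis]
  by (simp add: convex_cone_hull_Basis)

lemma inner_transpose_mult:
  fixes A :: "real^'n^'m"
  shows "(transpose A *v u) \<bullet> x = u \<bullet> (A *v x)"
  by (simp add: dot_lmul_matrix)

lemma inner_le_inner_nonneg_vec:
  fixes u :: "real^'m"
  assumes "0 \<le> u" "x \<le> y"
  shows "u \<bullet> x \<le> u \<bullet> y"
  using assms by (auto simp: inner_vec_def less_eq_vec_def intro!: sum_mono mult_left_mono)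

text \<open>Strong duality for a feasible system: a bound that holds on the whole polyhedron is
  certified by nonnegative row multipliers. Otherwise \<open>(n, h)\<close> is strictly separated
  from a closed convex cone, and the separating functional yields a feasible point violating the
  bound.\<close>

lemma affine_Farkas:
  fixes A :: "real^'n^'m" and b :: "real^'m" and n :: "real^'n"
  assumes feasible: "A *v x0 \<le> b"
    and bound: "\<And>x. A *v x \<le> b \<Longrightarrow> n \<bullet> x \<le> h"
  obtains u where "0 \<le> u" "transpose A *v u = n" "u \<bullet> b \<le> h"
proof -
  \<comment> \<open>The slack \<open>s\<close> turns \<open>u \<bullet> b \<le> h\<close> into an
    equation, so that a certificate exists exactly when \<open>(n, h)\<close> lies in the image of
    the orthant \<open>Q\<close>.\<close>
  define f :: "(real^'m) \<times> real \<Rightarrow> (real^'n) \<times> real"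
    where "f = (\<lambda>(u, s). (transpose A *v u, u \<bullet> b + s))"
  define Q where "Q = {p :: (real^'m) \<times> real. \<forall>i\<in>Basis. 0 \<le> p \<bullet> i}"
  have Q_iff: "(u, s) \<in> Q \<longleftrightarrow> 0 \<le> u \<and> 0 \<le> s" for u s
    by (auto simp: Q_def Basis_prod_def Basis_vec_def inner_axis less_eq_vec_def)
  have lin: "linear f"
    by (rule linearI)
      (auto simp: f_def matrix_vector_right_distrib algebra_simps scaleR_vector_matrix_assoc)
  have "(n, h) \<in> f ` Q"
  proof (rule ccontr)
    assume "(n, h) \<notin> f ` Q"
    moreover have "convex Q"
      unfolding Q_def convex_cone_hull_Basis[symmetric] by (rule convex_convex_cone_hull)
    then have "convex (f ` Q)"
      using lin by (simp add: convex_linear_image)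
    ultimately obtain a \<beta> where a: "a \<bullet> (n, h) < \<beta>" and \<beta>: "\<And>k. k \<in> f ` Q \<Longrightarrow> \<beta> < a \<bullet> k"
      using separating_hyperplane_closed_point[of "f ` Q" "(n, h)"]
        closed_linear_image_nonneg_orthant[OF lin] unfolding Q_def[symmetric] by blast
    obtain y t where [simp]: "a = (y, t)" by force
    have sep: "\<beta> < u \<bullet> (A *v y) + t * (u \<bullet> b + s)" if "0 \<le> u" "0 \<le> s" for u s
    proof -
      have "f (u, s) \<in> f ` Q" using that by (intro imageI) (simp add: Q_iff)
      then show ?thesis
        using \<beta>[of "f (u, s)"] by (simp add: f_def inner_commute[of y] dot_lmul_matrix)
    qed
    have "\<beta> < 0" using sep[of 0 0] by simp
    \<comment> \<open>\<open>Q\<close> is a cone: a negative value could be rescaled to be exactly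
      \<open>\<beta>\<close>, against the strict separation.\<close>
    have nonneg: "0 \<le> u \<bullet> (A *v y) + t * (u \<bullet> b + s)" if us: "0 \<le> u" "0 \<le> s" for u s
    proof (rule ccontr)
      let ?w = "u \<bullet> (A *v y) + t * (u \<bullet> b + s)"
      assume neg: "\<not> 0 \<le> ?w"
      define c where "c = \<beta> / ?w"
      have "c \<ge> 0" using neg \<open>\<beta> < 0\<close> by (simp add: c_def divide_nonpos_neg)
      then have "\<beta> < c * ?w"
        using sep[of "c *\<^sub>R u" "c * s"] us by (simp add: less_eq_vec_def algebra_simps)
      also have "c * ?w = \<beta>" using neg by (simp add: c_def)
      finally show False by simp
    qed
    have "t \<ge> 0" using nonneg[of 0 1] by simp
    have ray: "- (A *v y) \<le> t *\<^sub>R b"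
      unfolding less_eq_vec_def
    proof
      fix i
      have "(0 :: real^'m) \<le> axis i 1" by (simp add: less_eq_vec_def axis_def)
      then show "(- (A *v y)) $ i \<le> (t *\<^sub>R b) $ i"
        using nonneg[of "axis i 1" 0] by (simp add: inner_axis')
    qed
    \<comment> \<open>Since \<open>n \<bullet> y + t * h < \<beta> < 0\<close>, a step of length
      \<open>c\<close> along \<open>- y\<close> gains at least
      \<open>h - n \<bullet> x0 + 1\<close>; the extra 1 pushes the objective strictly past
      \<open>h\<close>.\<close>
    define c where "c = (h - n \<bullet> x0 + 1) / (- \<beta>)"
    have "c \<ge> 0" using bound[OF feasible] \<open>\<beta> < 0\<close> unfolding c_def by (intro divide_nonneg_pos) auto
    have pos: "1 + c * t > 0" using \<open>c \<ge> 0\<close> \<open>t \<ge> 0\<close> by (simp add: add_pos_nonneg)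
    \<comment> \<open>This combination treats the cases \<open>t = 0\<close> (an unbounded ray) and \<open>t > 0\<close> (a violating
      point) at once.\<close>
    define x where "x = (x0 - c *\<^sub>R y) /\<^sub>R (1 + c * t)"
    have "A *v x \<le> b"
      unfolding less_eq_vec_def
    proof
      fix i
      have "(A *v x) $ i = ((A *v x0) $ i + c * - (A *v y) $ i) / (1 + c * t)"
        by (simp add: x_def matrix_vector_mult_scaleR matrix_vector_mult_diff_distrib divide_inverse
            mult.commute)
      also have "\<dots> \<le> (b $ i + c * (t * b $ i)) / (1 + c * t)"
        using feasible ray \<open>c \<ge> 0\<close> pos
        by (intro divide_right_mono add_mono mult_left_mono) (auto simp: less_eq_vec_def)
      also have "\<dots> = b $ i" using pos by (simp add: field_simps)
      finally show "(A *v x) $ i \<le> b $ i" .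
    qed
    have "n \<bullet> x = (n \<bullet> x0 - c * (n \<bullet> y)) / (1 + c * t)"
      by (simp add: x_def inner_diff_right divide_inverse mult.commute)
    with bound[OF \<open>A *v x \<le> b\<close>] have "n \<bullet> x0 - c * (n \<bullet> y) \<le> h * (1 + c * t)"
      using pos by (simp add: pos_divide_le_eq)
    moreover have "c * (n \<bullet> y + t * h) \<le> c * \<beta>"
      using a \<open>c \<ge> 0\<close> by (intro mult_left_mono) (auto simp: inner_commute mult.commute)
    moreover have "c * \<beta> = - (h - n \<bullet> x0 + 1)"
      using \<open>\<beta> < 0\<close> by (simp add: c_def)
    ultimately show False by (simp add: algebra_simps)
  qed
  then obtain u s where "(u, s) \<in> Q" "transpose A *v u = n" "u \<bullet> b + s = h"
    by (auto simp: f_def)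
  then show thesis by (intro that[of u]) (auto simp: Q_iff)
qed

section \<open>Signed distance of the origin to a convex set, by unit normals\<close>

lemma separating_unit_vector:
  fixes S T :: "'a::euclidean_space set"
  assumes "convex S" "convex T" "S \<noteq> {}" "T \<noteq> {}" "S \<inter> T = {}"
  shows "\<exists>n. norm n = 1 \<and> (\<forall>x\<in>S. \<forall>y\<in>T. n \<bullet> x \<le> n \<bullet> y)"
proof -
  obtain a \<beta> where "a \<noteq> 0" and a: "\<And>x. x \<in> S \<Longrightarrow> a \<bullet> x \<le> \<beta>" "\<And>y. y \<in> T \<Longrightarrow> \<beta> \<le> a \<bullet> y"
    using separating_hyperplane_sets[OF assms] by blast
  have "(a /\<^sub>R norm a) \<bullet> x \<le> (a /\<^sub>R norm a) \<bullet> y" if "x \<in> S" "y \<in> T" for x y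
    using order_trans[OF a(1)[OF that(1)] a(2)[OF that(2)]] by (simp add: mult_left_mono)
  moreover have "norm (a /\<^sub>R norm a) = 1" using \<open>a \<noteq> 0\<close> by simp
  ultimately show ?thesis by blast
qed

text \<open>\<open>M\<close> lies in a half-space. Cauchy-Schwarz bounds the distance to
  \<open>M\<close> from below, and points along \<open>n\<close> beyond the half-space bound the
  distance to the complement from above. Positive and negative parts of \<open>\<delta>\<close>
  cover both signs at once.\<close>

lemma signed_norm_le_support:
  fixes M :: "'a::euclidean_space set"
  assumes n: "norm n = 1" "\<And>z. z \<in> M \<Longrightarrow> n \<bullet> z \<le> - \<delta>"
  shows "ereal \<delta> \<le> (INF z\<in>M. ereal (norm z)) - (INF z\<in>- M. ereal (norm z))"
proof -
  have dist: "ereal (max \<delta> 0) \<le> (INF z\<in>M. ereal (norm z))"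
  proof (rule INF_greatest)
    fix z assume "z \<in> M"
    have "\<bar>n \<bullet> z\<bar> \<le> norm z" using Cauchy_Schwarz_ineq2[of n z] n(1) by simp
    then show "ereal (max \<delta> 0) \<le> ereal (norm z)" using n(2)[OF \<open>z \<in> M\<close>] by auto
  qed
  have pen: "(INF z\<in>- M. ereal (norm z)) \<le> ereal (max (- \<delta>) 0)"
  \<comment> \<open>The boundary point of the half-space along \<open>n\<close> may itself belong to
    \<open>M\<close>, hence the overshoot by \<open>e\<close>.\<close>
  proof (rule ereal_le_epsilon2)
    fix e :: real assume "0 < e"
    let ?t = "max (- \<delta>) 0 + e"
    have "n \<bullet> n = 1" using n(1) by (simp add: norm_eq_1)
    then have "?t *\<^sub>R n \<in> - M" using n(2)[of "?t *\<^sub>R n"] \<open>0 < e\<close> by auto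
    then have "(INF z\<in>- M. ereal (norm z)) \<le> ereal (norm (?t *\<^sub>R n))" by (rule INF_lower)
    also have "\<dots> = ereal (max (- \<delta>) 0) + ereal e"
      using n(1) \<open>0 < e\<close> by (simp del: ereal_max)
    finally show "(INF z\<in>- M. ereal (norm z)) \<le> ereal (max (- \<delta>) 0) + ereal e" .
  qed
  have "ereal \<delta> = ereal (max \<delta> 0) - ereal (max (- \<delta>) 0)"
    by (simp add: max_def del: ereal_max)
  also have "\<dots> \<le> (INF z\<in>M. ereal (norm z)) - (INF z\<in>- M. ereal (norm z))"
    by (rule ereal_minus_mono[OF dist pen])
  finally show ?thesis .
qed

text \<open>One of the two infima vanishes, according to whether the origin lies in
  \<open>M\<close>. If it does, hyperplanes through nearby points outside \<open>M\<close> have a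
  limiting normal; if not, \<open>M\<close> is separated from a ball around the origin or from the
  origin itself.\<close>

lemma support_le_signed_norm:
  fixes M :: "'a::euclidean_space set"
  assumes "convex M" "M \<noteq> {}"
    and sd: "ereal \<delta> \<le> (INF z\<in>M. ereal (norm z)) - (INF z\<in>- M. ereal (norm z))"
  obtains n where "norm n = 1" "\<And>z. z \<in> M \<Longrightarrow> n \<bullet> z \<le> - \<delta>"
proof (cases "0 \<in> M")
  case True
  have "(INF z\<in>M. ereal (norm z)) \<le> ereal (norm (0 :: 'a))" by (rule INF_lower[OF True])
  also have "\<dots> = 0" by simp
  finally have "(INF z\<in>M. ereal (norm z)) \<le> 0" .
  moreover have "0 \<le> (INF z\<in>M. ereal (norm z))" by (intro INF_greatest) simp
  ultimately have "(INF z\<in>M. ereal (norm z)) = 0" by (rule antisym)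
  \<comment> \<open>An infinite infimum would make the difference \<open>-\<infinity>\<close>, which
    \<open>sd\<close> excludes.\<close>
  with sd have pen: "(INF z\<in>- M. ereal (norm z)) \<le> ereal (- \<delta>)"
    by (cases "INF z\<in>- M. ereal (norm z)") auto
  \<comment> \<open>The infimum over the complement need not be attained, so points of almost
    minimal norm are separated from \<open>M\<close>; compactness of the unit sphere then removes
    the error.\<close>
  have "\<exists>n. norm n = 1 \<and> (\<forall>z\<in>M. n \<bullet> z \<le> - \<delta> + inverse (Suc k))" for k
  proof -
    have "(INF z\<in>- M. ereal (norm z)) < ereal (- \<delta> + inverse (Suc k))"
      using pen by (rule order.strict_trans1) simp
    then obtain p where p: "p \<notin> M" "norm p < - \<delta> + inverse (Suc k)"
      by (auto simp: INF_less_iff)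
    obtain n where n: "norm n = 1" "\<And>z. z \<in> M \<Longrightarrow> n \<bullet> z \<le> n \<bullet> p"
      using separating_unit_vector[of M "{p}"] assms p by auto
    have "n \<bullet> p \<le> norm p" using norm_cauchy_schwarz[of n p] n(1) by simp
    with n p show ?thesis by (intro exI[of _ n]) force
  qed
  then obtain N where N: "\<And>k. norm (N k) = 1"
      "\<And>k z. z \<in> M \<Longrightarrow> N k \<bullet> z \<le> - \<delta> + inverse (Suc k)"
    by metis
  obtain n r where "n \<in> sphere 0 1" "strict_mono (r :: nat \<Rightarrow> nat)" and lim: "(N \<circ> r) \<longlonglongrightarrow> n"
    using compact_sphere[of "0 :: 'a" 1] N(1) unfolding compact_def by (metis mem_sphere_0)
  have "n \<bullet> z \<le> - \<delta>" if "z \<in> M" for z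
  proof (rule LIMSEQ_le)
    show "(\<lambda>k. (N \<circ> r) k \<bullet> z) \<longlonglongrightarrow> n \<bullet> z" by (intro tendsto_intros lim)
    have "(\<lambda>k. inverse (real (Suc (r k)))) \<longlonglongrightarrow> 0"
      using LIMSEQ_subseq_LIMSEQ[OF LIMSEQ_inverse_real_of_nat \<open>strict_mono r\<close>] by (simp add: o_def)
    then show "(\<lambda>k. - \<delta> + inverse (real (Suc (r k)))) \<longlonglongrightarrow> - \<delta>"
      using tendsto_add[OF tendsto_const[of "- \<delta>"]] by fastforce
    show "\<exists>k0. \<forall>k\<ge>k0. (N \<circ> r) k \<bullet> z \<le> - \<delta> + inverse (real (Suc (r k)))"
      using N(2)[OF that] by auto
  qed
  with \<open>n \<in> sphere 0 1\<close> show thesis by (intro that[of n]) auto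
next
  case False
  then have "(INF z\<in>- M. ereal (norm z)) \<le> ereal (norm (0 :: 'a))" by (intro INF_lower) simp
  also have "\<dots> = 0" by simp
  finally have "(INF z\<in>- M. ereal (norm z)) \<le> 0" .
  moreover have "0 \<le> (INF z\<in>- M. ereal (norm z))" by (intro INF_greatest) simp
  ultimately have "(INF z\<in>- M. ereal (norm z)) = 0" by (rule antisym)
  with sd have dist: "ereal \<delta> \<le> (INF z\<in>M. ereal (norm z))" by simp
  have far: "\<delta> \<le> norm z" if "z \<in> M" for z
    using order_trans[OF dist INF_lower[OF that]] by simp
  show thesis
  proof (cases "\<delta> > 0")
    case True
    have "M \<inter> ball 0 \<delta> = {}" using far by force
    then obtain n where n: "norm n = 1" "\<And>z y. z \<in> M \<Longrightarrow> y \<in> ball 0 \<delta> \<Longrightarrow> n \<bullet> z \<le> n \<bullet> y"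
      using separating_unit_vector[of M "ball 0 \<delta>"] assms True
      by (metis centre_in_ball convex_ball emptyE)
    have "n \<bullet> z \<le> - \<delta>" if "z \<in> M" for z
    proof -
      \<comment> \<open>The ball is open, so the test points are \<open>- r *\<^sub>R n\<close> with
        \<open>r\<close> below \<open>\<delta>\<close>.\<close>
      have "\<delta> \<le> - (n \<bullet> z)"
      proof (rule dense_le_bounded[OF True])
        fix r assume "0 < r" "r < \<delta>"
        then show "r \<le> - (n \<bullet> z)"
          using n(2)[OF that, of "- r *\<^sub>R n"] n(1) by (simp add: norm_eq_1)
      qed
      then show ?thesis by simp
    qed
    with n(1) show thesis by (rule that)
  next
    case \<delta>: False
    \<comment> \<open>For nonpositive \<open>\<delta>\<close>, separation from the origin suffices
      because \<open>0 \<le> - \<delta>\<close>.\<close>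
    obtain n where n: "norm n = 1" "\<And>z. z \<in> M \<Longrightarrow> n \<bullet> z \<le> 0"
      using separating_unit_vector[of M "{0}"] assms False by auto
    with \<delta> show thesis by (intro that[of n]) force+
  qed
qed

section \<open>Reduction to the set of differences, and the multipliers\<close>

lemma convex_polyhedron_system:
  fixes A :: "real^'n^'m"
  shows "convex {x. A *v x \<le> b}"
proof -
  have "{x. A *v x \<le> b} = (\<lambda>x. A *v x) -` {..b}" by auto
  moreover have "convex {..b}"
    unfolding convex_def by (auto simp: less_eq_vec_def intro!: convex_bound_le)
  ultimately show ?thesis
    using convex_linear_vimage[OF matrix_vector_mul_linear] by metis
qed

lemma signed_distance_differences:
  "signed_distance S T =
    (INF z\<in>{t - s | s t. s \<in> S \<and> t \<in> T}. ereal (norm z)) -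
    (INF z\<in>- {t - s | s t. s \<in> S \<and> t \<in> T}. ereal (norm z))"
proof -
  have iff: "(\<lambda>v. v + z) ` S \<inter> T \<noteq> {} \<longleftrightarrow> z \<in> {t - s | s t. s \<in> S \<and> t \<in> T}" for z
    by (force simp: algebra_simps)
  have "{z. (\<lambda>v. v + z) ` S \<inter> T \<noteq> {}} = {t - s | s t. s \<in> S \<and> t \<in> T}"
    using iff by blast
  moreover have "{z. (\<lambda>v. v + z) ` S \<inter> T = {}} = - {t - s | s t. s \<in> S \<and> t \<in> T}"
    using iff by blast
  ultimately show ?thesis
    unfolding signed_distance_def set_distance_def penetration_depth_def by simp
qed

lemma signed_distance_ge_iff_support:
  assumes "convex S" "convex T" "S \<noteq> {}" "T \<noteq> {}"
  shows "ereal \<delta> \<le> signed_distance S T \<longleftrightarrow>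
    (\<exists>n. norm n = 1 \<and> (\<forall>s\<in>S. \<forall>t\<in>T. n \<bullet> (t - s) \<le> - \<delta>))"
proof -
  define M where "M = {t - s | s t. s \<in> S \<and> t \<in> T}"
  have "M = (\<Union>t\<in>T. \<Union>s\<in>S. {t - s})" unfolding M_def by blast
  then have "convex M" using convex_differences[OF assms(2,1)] by simp
  have "M \<noteq> {}" using assms unfolding M_def by blast
  have "ereal \<delta> \<le> signed_distance S T \<longleftrightarrow> (\<exists>n. norm n = 1 \<and> (\<forall>z\<in>M. n \<bullet> z \<le> - \<delta>))"
    unfolding signed_distance_differences M_def[symmetric]
  proof
    assume "ereal \<delta> \<le> (INF z\<in>M. ereal (norm z)) - (INF z\<in>- M. ereal (norm z))"
    from support_le_signed_norm[OF \<open>convex M\<close> \<open>M \<noteq> {}\<close> this]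
    show "\<exists>n. norm n = 1 \<and> (\<forall>z\<in>M. n \<bullet> z \<le> - \<delta>)" by metis
  next
    assume "\<exists>n. norm n = 1 \<and> (\<forall>z\<in>M. n \<bullet> z \<le> - \<delta>)"
    then show "ereal \<delta> \<le> (INF z\<in>M. ereal (norm z)) - (INF z\<in>- M. ereal (norm z))"
      using signed_norm_le_support by auto
  qed
  also have "\<dots> \<longleftrightarrow> (\<exists>n. norm n = 1 \<and> (\<forall>s\<in>S. \<forall>t\<in>T. n \<bullet> (t - s) \<le> - \<delta>))"
    unfolding M_def by blast
  finally show ?thesis .
qed

theorem proposition1:
  fixes C :: "real^2^'l" and d :: "real^'l"
    and A :: "real^2^'m" and b :: "real^'m"
    and vessel obstacle :: "(real^2) set"
    and d_safe :: real
  assumes vessel: "vessel = {x. C *v x \<le> d}"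
    and obstacle: "obstacle = {x. A *v x \<le> b}"
    and vessel_nonempty: "vessel \<noteq> {}"
    and obstacle_nonempty: "obstacle \<noteq> {}"
  shows "signed_distance vessel obstacle \<ge> ereal d_safe \<longleftrightarrow>
    (\<exists>(lam :: real^'l) (mu :: real^'m).
        lam \<ge> 0 \<and> mu \<ge> 0 \<and> transpose A *v mu \<noteq> 0 \<and>
        (- (lam \<bullet> d) - mu \<bullet> b) / norm (transpose A *v mu) \<ge> d_safe \<and>
        transpose C *v lam + transpose A *v mu = 0)" (is "_ \<longleftrightarrow> ?R")
proof -
  obtain v0 o0 where v0: "v0 \<in> vessel" and o0: "o0 \<in> obstacle"
    using vessel_nonempty obstacle_nonempty by blast
  have "ereal d_safe \<le> signed_distance vessel obstacle \<longleftrightarrow>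
      (\<exists>n. norm n = 1 \<and> (\<forall>s\<in>vessel. \<forall>t\<in>obstacle. n \<bullet> (t - s) \<le> - d_safe))"
    using vessel_nonempty obstacle_nonempty
    by (intro signed_distance_ge_iff_support) (auto simp: vessel obstacle convex_polyhedron_system)
  also have "\<dots> \<longleftrightarrow> ?R"
  proof
    assume "\<exists>n. norm n = 1 \<and> (\<forall>s\<in>vessel. \<forall>t\<in>obstacle. n \<bullet> (t - s) \<le> - d_safe)"
    then obtain n where n: "norm n = 1"
      and sep: "\<And>s t. s \<in> vessel \<Longrightarrow> t \<in> obstacle \<Longrightarrow> n \<bullet> t - n \<bullet> s \<le> - d_safe"
      by (auto simp: inner_diff_right)
    \<comment> \<open>The support value \<open>h\<close> decouples the joint inequality into one
      bound per polyhedron, so that duality applies to each separately.\<close>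
    define h where "h = (SUP t\<in>obstacle. n \<bullet> t)"
    have bdd: "bdd_above ((\<bullet>) n ` obstacle)"
      using sep[OF v0] by (intro bdd_aboveI2[where M = "n \<bullet> v0 - d_safe"]) force
    have "n \<bullet> t \<le> h" if "t \<in> obstacle" for t
      unfolding h_def by (rule cSUP_upper[OF that bdd])
    then obtain mu where mu: "0 \<le> mu" "transpose A *v mu = n" "mu \<bullet> b \<le> h"
      using affine_Farkas[of A o0 b n h] o0 by (auto simp: obstacle)
    have "- n \<bullet> s \<le> - d_safe - h" if "s \<in> vessel" for s
    proof -
      have "h \<le> n \<bullet> s - d_safe"
        unfolding h_def using sep[OF that] by (intro cSUP_least[OF obstacle_nonempty]) force
      then show ?thesis by simp
    qed
    then obtain lam where lam: "0 \<le> lam" "transpose C *v lam = - n" "lam \<bullet> d \<le> - d_safe - h"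
      using affine_Farkas[of C v0 d "- n" "- d_safe - h"] v0 by (auto simp: vessel)
    have "transpose A *v mu \<noteq> 0" using mu(2) n by auto
    \<comment> \<open>The denominator is \<open>norm n = 1\<close>, and \<open>h\<close> cancels
      when the two multiplier bounds are added.\<close>
    then show ?R using mu lam n by (intro exI[of _ lam] exI[of _ mu]) auto
  next
    assume ?R
    then obtain lam mu where lam: "0 \<le> lam" and mu: "0 \<le> mu"
      and nz: "transpose A *v mu \<noteq> 0"
      and le: "d_safe \<le> (- (lam \<bullet> d) - mu \<bullet> b) / norm (transpose A *v mu)"
      and eq: "transpose C *v lam + transpose A *v mu = 0"
      by blast
    define w where "w = transpose A *v mu"
    have C: "transpose C *v lam = - w" using eq by (simp add: w_def eq_neg_iff_add_eq_0)
    have w: "norm w > 0" using nz by (simp add: w_def)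
    \<comment> \<open>Weak duality: the multipliers bound \<open>w \<bullet> t\<close> and
      \<open>- w \<bullet> s\<close> separately; adding these bounds and normalising
      \<open>w\<close> gives the required unit vector.\<close>
    have "(w /\<^sub>R norm w) \<bullet> (t - s) \<le> - d_safe" if "s \<in> vessel" "t \<in> obstacle" for s t
    proof -
      have "w \<bullet> t \<le> mu \<bullet> b"
        unfolding w_def inner_transpose_mult
        using mu that(2) by (intro inner_le_inner_nonneg_vec) (auto simp: obstacle)
      moreover have "- w \<bullet> s \<le> lam \<bullet> d"
        unfolding C[symmetric] inner_transpose_mult
        using lam that(1) by (intro inner_le_inner_nonneg_vec) (auto simp: vessel)
      moreover have "d_safe * norm w \<le> - (lam \<bullet> d) - mu \<bullet> b"
        using le w unfolding w_def[symmetric] by (simp add: pos_le_divide_eq)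
      ultimately have "w \<bullet> (t - s) \<le> - d_safe * norm w" by (simp add: inner_diff_right)
      then show ?thesis using w by (simp add: field_simps)
    qed
    moreover have "norm (w /\<^sub>R norm w) = 1" using w by simp
    ultimately show "\<exists>n. norm n = 1 \<and> (\<forall>s\<in>vessel. \<forall>t\<in>obstacle. n \<bullet> (t - s) \<le> - d_safe)"
      by blast
  qed
  finally show ?thesis .
qed

end
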